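(* Let $\mathcal M$ be a finite von Neumann algebra acting on a Hilbert space $\mathcal H$, with a faithful, normal, tracial state $\tau$. Let $E\in\mathcal I(\tilde{\mathcal M})$. Then the range of $E$, $\mathrm{range}(E)$, and the kernel of $E$, $\ker(E)$ (which is the range of $\mathbf 1-E$), are closed subspaces of $\mathcal H$ with $$\mathrm{range}(E)\cap\ker(E)=\{0\}\quad\text{and}\quad\overline{\mathrm{range}(E)+\ker(E)}=\mathcal H.$$ Moreover, $\mathcal D(E)=\mathrm{range}(E)+\ker(E)$. Conversely, if $P,Q\in\mathcal M$ are projections with $P\wedge Q=0$ and $P\vee Q=\mathbf 1$, then there is a unique idempotent $E\in\tilde{\mathcal M}$ with $\mathcal D(E)=P(\mathcal H)+Q(\mathcal H)$, $\mathrm{range}(E)=P(\mathcal H)$ and $\ker(E)=Q(\mathcal H)$, and $E$ is determined by $$E\xi=\begin{cases}\xi,&\xi\in P(\mathcal H),\\0,&\xi\in Q(\mathcal H).\end{cases}$$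
   Context: $\tilde{\mathcal M}$ is the $*$-algebra of closed, densely defined operators on $\mathcal H$ affiliated with $\mathcal M$ (i.e. commuting with every unitary in $\mathcal M'$), with sum $\overline{x+y}$ and product $\overline{x\cdot y}$ (closures of the operator sum and composition, which are again closed, densely defined and affiliated with $\mathcal M$). $\mathcal I(\tilde{\mathcal M})$ is the set of idempotents of $\tilde{\mathcal M}$, i.e. operators $E\in\tilde{\mathcal M}$ with $\overline{E\cdot E}=E$. $\mathcal D(E)$ denotes the domain of $E$. *)

theory Defs
  imports "HOL-Analysis.Analysis" "HOL-Library.Set_Algebras"
begin

(* The inner product is linear in the first argument.  Positive definiteness of cinner and the
   completeness of the space come from the norm, via cinner_self and the superclass banach. *)
class complex_hilbert_space = banach +
  fixes scaleC :: "complex \<Rightarrow> 'a \<Rightarrow> 'a"  (infixr "*\<^sub>C" 75)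
    and cinner :: "'a \<Rightarrow> 'a \<Rightarrow> complex"
  assumes scaleC_add_right: "c *\<^sub>C (x + y) = c *\<^sub>C x + c *\<^sub>C y"
    and scaleC_add_left: "(c + d) *\<^sub>C x = c *\<^sub>C x + d *\<^sub>C x"
    and scaleC_scaleC: "c *\<^sub>C d *\<^sub>C x = (c * d) *\<^sub>C x"
    and scaleC_one: "1 *\<^sub>C x = x"
    and scaleR_scaleC: "r *\<^sub>R x = complex_of_real r *\<^sub>C x"
    and cinner_add_left: "cinner (x + y) z = cinner x z + cinner y z"
    and cinner_scaleC_left: "cinner (c *\<^sub>C x) y = c * cinner x y"
    and cinner_commute: "cinner x y = cnj (cinner y x)"
    and cinner_self: "cinner x x = complex_of_real ((norm x)\<^sup>2)"

instantiation complex :: complex_hilbert_space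
begin

definition scaleC_complex :: "complex \<Rightarrow> complex \<Rightarrow> complex"
  where "scaleC_complex c x = c * x"

definition cinner_complex :: "complex \<Rightarrow> complex \<Rightarrow> complex"
  where "cinner_complex x y = x * cnj y"

instance
proof
  fix c d x y z :: complex and r :: real
  show "c *\<^sub>C (x + y) = c *\<^sub>C x + c *\<^sub>C y"
    and "(c + d) *\<^sub>C x = c *\<^sub>C x + d *\<^sub>C x"
    and "c *\<^sub>C d *\<^sub>C x = (c * d) *\<^sub>C x"
    and "1 *\<^sub>C x = x"
    and "r *\<^sub>R x = complex_of_real r *\<^sub>C x"
    by (simp_all add: scaleC_complex_def distrib_left distrib_right scaleR_conv_of_real)
  show "cinner (x + y) z = cinner x z + cinner y z"
    and "cinner (c *\<^sub>C x) y = c * cinner x y"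
    and "cinner x y = cnj (cinner y x)"
    by (simp_all add: cinner_complex_def scaleC_complex_def distrib_right)
  show "cinner x x = complex_of_real ((norm x)\<^sup>2)"
    by (simp only: cinner_complex_def complex_norm_square)
qed

end

global_interpretation complex_vector:
  vector_space "scaleC :: complex \<Rightarrow> 'a \<Rightarrow> 'a::complex_hilbert_space"
  by unfold_locales (rule scaleC_add_right scaleC_add_left scaleC_scaleC scaleC_one)+

abbreviation csubspace :: "'a::complex_hilbert_space set \<Rightarrow> bool"
  where "csubspace \<equiv> complex_vector.subspace"


subsection \<open>Bounded operators and projections\<close>

definition bounded_ops :: "('a::complex_hilbert_space \<Rightarrow> 'a) set"
  where "bounded_ops = {x. bounded_linear x \<and> (\<forall>c \<xi>. x (c *\<^sub>C \<xi>) = c *\<^sub>C x \<xi>)}"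

definition adj :: "('a::complex_hilbert_space \<Rightarrow> 'a) \<Rightarrow> 'a \<Rightarrow> 'a"
  where "adj x \<eta> = (THE \<zeta>. \<forall>\<xi>. cinner (x \<xi>) \<eta> = cinner \<xi> \<zeta>)"

definition selfadjoint :: "('a::complex_hilbert_space \<Rightarrow> 'a) \<Rightarrow> bool"
  where "selfadjoint x \<longleftrightarrow> x \<in> bounded_ops \<and> adj x = x"

definition unitary_op :: "('a::complex_hilbert_space \<Rightarrow> 'a) \<Rightarrow> bool"
  where "unitary_op u \<longleftrightarrow> u \<in> bounded_ops \<and> adj u \<circ> u = id \<and> u \<circ> adj u = id"

definition is_projection :: "('a::complex_hilbert_space \<Rightarrow> 'a) \<Rightarrow> bool"
  where "is_projection p \<longleftrightarrow> selfadjoint p \<and> p \<circ> p = p"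

definition proj_onto :: "'a::complex_hilbert_space set \<Rightarrow> 'a \<Rightarrow> 'a"
  where "proj_onto S = (THE p. is_projection p \<and> range p = S)"

definition proj_inf :: "('a::complex_hilbert_space \<Rightarrow> 'a) \<Rightarrow> ('a \<Rightarrow> 'a) \<Rightarrow> 'a \<Rightarrow> 'a"
  where "proj_inf p q = proj_onto (range p \<inter> range q)"

definition proj_sup :: "('a::complex_hilbert_space \<Rightarrow> 'a) \<Rightarrow> ('a \<Rightarrow> 'a) \<Rightarrow> 'a \<Rightarrow> 'a"
  where "proj_sup p q = proj_onto (closure (range p + range q))"

(* The order of self-adjoint operators; the quadratic form of such an operator is real. *)
definition op_le :: "('a::complex_hilbert_space \<Rightarrow> 'a) \<Rightarrow> ('a \<Rightarrow> 'a) \<Rightarrow> bool"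
  where "op_le x y \<longleftrightarrow> (\<forall>\<xi>. Re (cinner (x \<xi>) \<xi>) \<le> Re (cinner (y \<xi>) \<xi>))"


subsection \<open>Von Neumann algebras and states\<close>

definition commutant :: "('a::complex_hilbert_space \<Rightarrow> 'a) set \<Rightarrow> ('a \<Rightarrow> 'a) set"
  where "commutant M = {y \<in> bounded_ops. \<forall>x\<in>M. x \<circ> y = y \<circ> x}"

(* A bicommutant is automatically a unital subalgebra of the bounded operators. *)
definition von_neumann_algebra :: "('a::complex_hilbert_space \<Rightarrow> 'a) set \<Rightarrow> bool"
  where "von_neumann_algebra M \<longleftrightarrow>
    M \<subseteq> bounded_ops \<and> (\<forall>x\<in>M. adj x \<in> M) \<and> commutant (commutant M) = M"

(* Finiteness: every isometry in M is unitary, i.e. the identity is a finite projection. *)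
definition finite_von_neumann_algebra :: "('a::complex_hilbert_space \<Rightarrow> 'a) set \<Rightarrow> bool"
  where "finite_von_neumann_algebra M \<longleftrightarrow>
    von_neumann_algebra M \<and> (\<forall>v\<in>M. adj v \<circ> v = id \<longrightarrow> v \<circ> adj v = id)"

(* Functionals on M are total functions; only their values on M matter. *)
definition state_on :: "('a::complex_hilbert_space \<Rightarrow> 'a) set \<Rightarrow> (('a \<Rightarrow> 'a) \<Rightarrow> complex) \<Rightarrow> bool"
  where "state_on M \<tau> \<longleftrightarrow>
    (\<forall>x\<in>M. \<forall>y\<in>M. \<tau> (\<lambda>\<xi>. x \<xi> + y \<xi>) = \<tau> x + \<tau> y) \<and>
    (\<forall>c. \<forall>x\<in>M. \<tau> (\<lambda>\<xi>. c *\<^sub>C x \<xi>) = c * \<tau> x) \<and>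
    (\<forall>x\<in>M. \<tau> (adj x \<circ> x) \<in> \<real>\<^sub>\<ge>\<^sub>0) \<and>
    \<tau> id = 1"

definition tracial_on :: "('a::complex_hilbert_space \<Rightarrow> 'a) set \<Rightarrow> (('a \<Rightarrow> 'a) \<Rightarrow> complex) \<Rightarrow> bool"
  where "tracial_on M \<tau> \<longleftrightarrow> (\<forall>x\<in>M. \<forall>y\<in>M. \<tau> (x \<circ> y) = \<tau> (y \<circ> x))"

definition faithful_on :: "('a::complex_hilbert_space \<Rightarrow> 'a) set \<Rightarrow> (('a \<Rightarrow> 'a) \<Rightarrow> complex) \<Rightarrow> bool"
  where "faithful_on M \<tau> \<longleftrightarrow> (\<forall>x\<in>M. \<tau> (adj x \<circ> x) = 0 \<longrightarrow> x = (\<lambda>_. 0))"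

definition is_lub_in ::
  "('a::complex_hilbert_space \<Rightarrow> 'a) set \<Rightarrow> ('a \<Rightarrow> 'a) set \<Rightarrow> ('a \<Rightarrow> 'a) \<Rightarrow> bool"
  where "is_lub_in M D x \<longleftrightarrow>
    x \<in> M \<and> selfadjoint x \<and> (\<forall>d\<in>D. op_le d x) \<and>
    (\<forall>y\<in>M. selfadjoint y \<and> (\<forall>d\<in>D. op_le d y) \<longrightarrow> op_le x y)"

(* Normality of a positive functional: it preserves suprema of upward directed families of
   self-adjoint elements.  Positivity makes the real supremum below one of a bounded set. *)
definition normal_on :: "('a::complex_hilbert_space \<Rightarrow> 'a) set \<Rightarrow> (('a \<Rightarrow> 'a) \<Rightarrow> complex) \<Rightarrow> bool"
  where "normal_on M \<tau> \<longleftrightarrow>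
    (\<forall>D x. D \<subseteq> M \<and> (\<forall>d\<in>D. selfadjoint d) \<and> D \<noteq> {} \<and>
       (\<forall>d\<in>D. \<forall>e\<in>D. \<exists>f\<in>D. op_le d f \<and> op_le e f) \<and> is_lub_in M D x \<longrightarrow>
       Re (\<tau> x) = (SUP d\<in>D. Re (\<tau> d)))"


subsection \<open>Unbounded operators\<close>

(* A partially defined operator T is identified with its graph, a set of pairs (\<xi>, T \<xi>).
   Thus Domain T and Range T are its domain and range, and the closure of the operator is the
   topological closure of the set. *)
type_synonym 'a operator = "('a \<times> 'a) set"

definition lin_operator :: "'a::complex_hilbert_space operator \<Rightarrow> bool"
  where "lin_operator T \<longleftrightarrow> single_valued T \<and> (0, 0) \<in> T \<and>
    (\<forall>\<xi> \<eta> \<xi>' \<eta>'. (\<xi>, \<eta>) \<in> T \<and> (\<xi>', \<eta>') \<in> T \<longrightarrow> (\<xi> + \<xi>', \<eta> + \<eta>') \<in> T) \<and>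
    (\<forall>c \<xi> \<eta>. (\<xi>, \<eta>) \<in> T \<longrightarrow> (c *\<^sub>C \<xi>, c *\<^sub>C \<eta>) \<in> T)"

definition op_ker :: "'a::complex_hilbert_space operator \<Rightarrow> 'a set"
  where "op_ker T = {\<xi>. (\<xi>, 0) \<in> T}"

definition op_graph :: "('a::complex_hilbert_space \<Rightarrow> 'a) \<Rightarrow> 'a operator"
  where "op_graph x = {(\<xi>, x \<xi>) |\<xi>. True}"

(* The composition (S after T); relcomp lists its arguments in the opposite order. *)
definition op_comp ::
  "'a::complex_hilbert_space operator \<Rightarrow> 'a operator \<Rightarrow> 'a operator"
  where "op_comp S T = T O S"

definition op_plus ::
  "'a::complex_hilbert_space operator \<Rightarrow> 'a operator \<Rightarrow> 'a operator"
  where "op_plus S T = {(\<xi>, \<eta> + \<zeta>) |\<xi> \<eta> \<zeta>. (\<xi>, \<eta>) \<in> S \<and> (\<xi>, \<zeta>) \<in> T}"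

definition op_uminus :: "'a::complex_hilbert_space operator \<Rightarrow> 'a operator"
  where "op_uminus T = {(\<xi>, - \<eta>) |\<xi> \<eta>. (\<xi>, \<eta>) \<in> T}"

definition affiliated :: "('a::complex_hilbert_space \<Rightarrow> 'a) set \<Rightarrow> 'a operator set"
  where "affiliated M = {T. lin_operator T \<and> closed T \<and> closure (Domain T) = UNIV \<and>
    (\<forall>u\<in>commutant M. unitary_op u \<longrightarrow> op_comp (op_graph u) T = op_comp T (op_graph u))}"

definition strong_add ::
  "'a::complex_hilbert_space operator \<Rightarrow> 'a operator \<Rightarrow> 'a operator"
  where "strong_add S T = closure (op_plus S T)"

definition strong_mult ::
  "'a::complex_hilbert_space operator \<Rightarrow> 'a operator \<Rightarrow> 'a operator"
  where "strong_mult S T = closure (op_comp S T)"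

definition idempotents :: "('a::complex_hilbert_space \<Rightarrow> 'a) set \<Rightarrow> 'a operator set"
  where "idempotents M = {E \<in> affiliated M. strong_mult E E = E}"

end

theory Submission
  imports Defs
begin

text \<open>
  If \<open>E\<close> is a closed operator which is the closure of \<open>E \<cdot> E\<close>, then \<open>E\<close> already maps its domain
  into itself: any \<open>\<xi>\<close> in the domain is approximated in the graph norm by \<open>\<xi>\<^sub>n\<close> with
  \<open>E E \<xi>\<^sub>n = E \<xi>\<^sub>n\<close>, and closedness applied to \<open>(E \<xi>\<^sub>n, E \<xi>\<^sub>n)\<close> gives \<open>E E \<xi> = E \<xi>\<close>. Hence the range is
  \<open>{\<xi>. E \<xi> = \<xi>}\<close>, and \<open>\<xi> = E \<xi> + (\<xi> - E \<xi>)\<close> splits the domain. Conversely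
  \<open>{(\<xi> + \<eta>, \<xi>) | \<xi> \<in> P(H), \<eta> \<in> Q(H)}\<close> is the required graph; it is closed because it consists of the
  pairs \<open>(\<zeta>, \<xi>)\<close> with \<open>\<xi> \<in> P(H)\<close> and \<open>\<zeta> - \<xi> \<in> Q(H)\<close>.
\<close>

subsection \<open>Hilbert space geometry\<close>

lemmas scaleC_simps [simp] = complex_vector.scale_zero_left complex_vector.scale_zero_right
  complex_vector.scale_minus_left complex_vector.scale_minus_right scaleC_one

lemma cinner_add_right: "cinner x (y + z) = cinner x y + cinner x z"
  by (metis cinner_add_left cinner_commute complex_cnj_add)

lemma cinner_scaleC_right: "cinner x (c *\<^sub>C y) = cnj c * cinner x y"
  by (metis cinner_commute cinner_scaleC_left complex_cnj_mult)

lemma cinner_zero_left [simp]: "cinner 0 x = 0"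
  using cinner_add_left[of 0 0 x] by simp

lemma cinner_zero_right [simp]: "cinner x 0 = 0"
  using cinner_add_right[of x 0 0] by simp

lemma cinner_minus_left: "cinner (- x) y = - cinner x y"
  using cinner_add_left[of x "- x" y] by (simp add: add_eq_0_iff)

lemma cinner_minus_right: "cinner x (- y) = - cinner x y"
  using cinner_add_right[of x y "- y"] by (simp add: add_eq_0_iff)

lemma cinner_diff_left: "cinner (x - y) z = cinner x z - cinner y z"
  using cinner_add_left[of x "- y" z] by (simp add: cinner_minus_left)

lemma cinner_diff_right: "cinner x (y - z) = cinner x y - cinner x z"
  using cinner_add_right[of x y "- z"] by (simp add: cinner_minus_right)

lemma cinner_self_eq_0 [simp]: "cinner x x = 0 \<longleftrightarrow> x = 0"
  by (simp add: cinner_self)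

lemma cinner_eq_0_sym: "cinner x y = 0 \<longleftrightarrow> cinner y x = 0"
  by (metis cinner_commute complex_cnj_zero)

lemma norm_add_squared:
  "(norm (x + y))\<^sup>2 = (norm x)\<^sup>2 + (norm y)\<^sup>2 + 2 * Re (cinner (x::'a::complex_hilbert_space) y)"
proof -
  have "complex_of_real ((norm (x + y))\<^sup>2)
      = complex_of_real ((norm x)\<^sup>2) + complex_of_real ((norm y)\<^sup>2) + (cinner x y + cnj (cinner x y))"
    unfolding cinner_self[symmetric] cinner_add_left cinner_add_right
    using cinner_commute[of y x] by simp
  also have "\<dots> = complex_of_real ((norm x)\<^sup>2 + (norm y)\<^sup>2 + 2 * Re (cinner x y))"
    by (simp add: complex_add_cnj)
  finally show ?thesis
    using of_real_eq_iff by blast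
qed

lemma norm_diff_squared:
  "(norm (x - y))\<^sup>2 = (norm x)\<^sup>2 + (norm y)\<^sup>2 - 2 * Re (cinner (x::'a::complex_hilbert_space) y)"
  using norm_add_squared[of x "- y"] by (simp add: cinner_minus_right)

text \<open>The class provides homogeneity of the norm for real scalars only; for complex ones it
  follows by comparing squares, since \<open>cinner_self\<close> expresses the squared norm through
  \<open>cinner\<close>.\<close>

lemma norm_scaleC: "norm (c *\<^sub>C (x::'a::complex_hilbert_space)) = cmod c * norm x"
proof -
  have "complex_of_real ((norm (c *\<^sub>C x))\<^sup>2) = c * cnj c * cinner x x"
    unfolding cinner_self[symmetric] cinner_scaleC_left cinner_scaleC_right by simp
  also have "\<dots> = complex_of_real ((cmod c * norm x)\<^sup>2)"
    unfolding cinner_self complex_norm_square[symmetric] by (simp add: power_mult_distrib)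
  finally have "complex_of_real ((norm (c *\<^sub>C x))\<^sup>2) = complex_of_real ((cmod c * norm x)\<^sup>2)" .
  then show ?thesis
    by (simp only: of_real_eq_iff power2_eq_iff_nonneg norm_ge_zero zero_le_mult_iff) simp
qed

lemma parallelogram:
  fixes x y :: "'a::complex_hilbert_space"
  shows "(norm (x + y))\<^sup>2 + (norm (x - y))\<^sup>2 = 2 * (norm x)\<^sup>2 + 2 * (norm y)\<^sup>2"
  by (simp add: norm_add_squared norm_diff_squared)

lemma bounded_linear_scaleC: "bounded_linear (\<lambda>x::'a::complex_hilbert_space. c *\<^sub>C x)"
  by (rule bounded_linear_intro[where K = "cmod c"])
    (simp_all add: scaleC_add_right scaleR_scaleC scaleC_scaleC norm_scaleC mult.commute)

text \<open>Polarisation writes the real part through norms, which are continuous; the imaginary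
  part is the real part taken against \<open>\<i> *\<^sub>C y\<close>.\<close>

lemma continuous_cinner_left: "continuous_on UNIV (\<lambda>x::'a::complex_hilbert_space. cinner x y)"
proof -
  have re: "continuous_on UNIV (\<lambda>x::'a. Re (cinner x y))" for y
  proof -
    have "(\<lambda>x::'a. Re (cinner x y)) = (\<lambda>x. ((norm (x + y))\<^sup>2 - (norm x)\<^sup>2 - (norm y)\<^sup>2) / 2)"
      by (simp add: norm_add_squared)
    then show ?thesis
      by (simp only:) (intro continuous_intros, simp_all)
  qed
  have "(\<lambda>x. cinner x y) = (\<lambda>x. Complex (Re (cinner x y)) (Re (cinner x (\<i> *\<^sub>C y))))"
    by (simp add: cinner_scaleC_right complex_eq_iff)
  then show ?thesis
    by (simp only:) (intro continuous_on_Complex re)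
qed

section \<open>Closed subspaces and best approximation\<close>

lemma csubspace_closure:
  fixes S :: "'a::complex_hilbert_space set"
  assumes "csubspace S"
  shows "csubspace (closure S)"
  unfolding complex_vector.subspace_def
proof (intro conjI ballI allI)
  show "0 \<in> closure S"
    using complex_vector.subspace_0[OF assms] closure_subset by blast
next
  fix x y assume "x \<in> closure S" "y \<in> closure S"
  then obtain f g where "\<And>n. f n \<in> S" "f \<longlonglongrightarrow> x" "\<And>n. g n \<in> S" "g \<longlonglongrightarrow> y"
    unfolding closure_sequential by blast
  then have "\<And>n. f n + g n \<in> S" "(\<lambda>n. f n + g n) \<longlonglongrightarrow> x + y"
    by (auto intro: complex_vector.subspace_add[OF assms] tendsto_add)
  then show "x + y \<in> closure S"
    unfolding closure_sequential by (intro exI[of _ "\<lambda>n. f n + g n"]) simp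
next
  fix c x assume "x \<in> closure S"
  then obtain f where "\<And>n. f n \<in> S" "f \<longlonglongrightarrow> x"
    unfolding closure_sequential by blast
  then have "\<And>n. c *\<^sub>C f n \<in> S" "(\<lambda>n. c *\<^sub>C f n) \<longlonglongrightarrow> c *\<^sub>C x"
    by (auto intro: complex_vector.subspace_scale[OF assms]
        bounded_linear.tendsto[OF bounded_linear_scaleC])
  then show "c *\<^sub>C x \<in> closure S"
    unfolding closure_sequential by (intro exI[of _ "\<lambda>n. c *\<^sub>C f n"]) simp
qed

lemma csubspace_set_plus:
  fixes S T :: "'a::complex_hilbert_space set"
  assumes "csubspace S" "csubspace T"
  shows "csubspace (S + T)"
proof -
  have "S + T = {x + y |x y. x \<in> S \<and> y \<in> T}"
    by (auto simp: set_plus_def)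
  then show ?thesis
    using complex_vector.subspace_sums[OF assms] by simp
qed

text \<open>A minimising sequence is Cauchy by the parallelogram law, because midpoints stay in
  \<open>S\<close> and so cannot be closer to \<open>x\<close> than the infimum; completeness and
  closedness of \<open>S\<close> then give the minimiser.\<close>

lemma nearest_point_csubspace:
  fixes S :: "'a::complex_hilbert_space set"
  assumes S: "csubspace S" "closed S"
  obtains y where "y \<in> S" "\<And>s. s \<in> S \<Longrightarrow> norm (x - y) \<le> norm (x - s)"
proof -
  define d where "d = (INF s\<in>S. (norm (x - s))\<^sup>2)"
  have bdd: "bdd_below ((\<lambda>s. (norm (x - s))\<^sup>2) ` S)"
    by (rule bdd_belowI[of _ 0]) auto
  have ne: "S \<noteq> {}"
    using complex_vector.subspace_0[OF S(1)] by blast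
  have d_le: "d \<le> (norm (x - s))\<^sup>2" if "s \<in> S" for s
    unfolding d_def by (rule cINF_lower[OF bdd that])
  have "\<exists>s\<in>S. (norm (x - s))\<^sup>2 < d + 1 / real (Suc n)" for n
    using cINF_less_iff[OF ne bdd, of "d + 1 / real (Suc n)"] unfolding d_def by simp
  then obtain f where fS: "\<And>n. f n \<in> S"
    and f: "\<And>n. (norm (x - f n))\<^sup>2 < d + 1 / real (Suc n)"
    by metis
  have gap: "(norm (a - b))\<^sup>2 \<le> 2 * (norm (x - a))\<^sup>2 + 2 * (norm (x - b))\<^sup>2 - 4 * d"
    if "a \<in> S" "b \<in> S" for a b
  proof -
    let ?m = "(1/2) *\<^sub>R (a + b)"
    have "?m \<in> S"
      unfolding scaleR_scaleC using that S(1)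
      by (intro complex_vector.subspace_scale complex_vector.subspace_add)
    have "(x - a) + (x - b) = 2 *\<^sub>R (x - ?m)"
      by (simp add: algebra_simps scaleR_2)
    then have "(norm ((x - a) + (x - b)))\<^sup>2 = 4 * (norm (x - ?m))\<^sup>2"
      by (simp add: power_mult_distrib)
    moreover have "norm ((x - a) - (x - b)) = norm (a - b)"
      by (simp add: norm_minus_commute)
    ultimately show ?thesis
      using parallelogram[of "x - a" "x - b"] d_le[OF \<open>?m \<in> S\<close>] by simp
  qed
  have "Cauchy f"
    unfolding Cauchy_def
  proof (intro allI impI)
    fix e :: real assume "e > 0"
    \<comment> \<open>In \<open>gap\<close> the excesses over \<open>d\<close> at \<open>m\<close>
      and at \<open>n\<close> count twice each, so four times \<open>1 / real (Suc N)\<close> must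
      stay below \<open>e\<^sup>2\<close>.\<close>
    then obtain N where N: "1 / real (Suc N) < e\<^sup>2 / 4"
      using nat_approx_posE[of "e\<^sup>2 / 4"] by auto
    have "dist (f m) (f n) < e" if "m \<ge> N" "n \<ge> N" for m n
    proof -
      have "1 / real (Suc m) \<le> 1 / real (Suc N)" "1 / real (Suc n) \<le> 1 / real (Suc N)"
        using that by (auto simp: field_simps)
      then have "(norm (f m - f n))\<^sup>2 < e\<^sup>2"
        using gap[OF fS fS, of m n] f[of m] f[of n] N by linarith
      then show ?thesis
        using \<open>e > 0\<close> by (simp add: dist_norm power2_less_imp_less)
    qed
    then show "\<exists>M. \<forall>m\<ge>M. \<forall>n\<ge>M. dist (f m) (f n) < e" by blast
  qed
  then obtain y where y: "f \<longlonglongrightarrow> y"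
    using Cauchy_convergent convergent_def by blast
  have "y \<in> S"
    using closed_sequentially[OF S(2)] fS y by blast
  have "(\<lambda>n. (norm (x - f n))\<^sup>2) \<longlonglongrightarrow> (norm (x - y))\<^sup>2"
    by (intro tendsto_intros y)
  moreover have "(\<lambda>n. d + 1 / real (Suc n)) \<longlonglongrightarrow> d + 0"
    by (intro tendsto_add tendsto_const LIMSEQ_Suc[OF lim_1_over_n])
  ultimately have "(norm (x - y))\<^sup>2 \<le> d + 0"
    by (rule LIMSEQ_le) (intro exI allI impI less_imp_le f)
  then have "norm (x - y) \<le> norm (x - s)" if "s \<in> S" for s
    using power2_le_imp_le[OF order_trans[OF _ d_le[OF that]] norm_ge_zero] by simp
  with \<open>y \<in> S\<close> show ?thesis
    by (rule that)
qed

text \<open>First variation at the nearest point \<open>y\<close>: were \<open>x - y\<close> not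
  orthogonal to some \<open>s\<close>, moving \<open>y\<close> by a small multiple of
  \<open>s\<close> would decrease the distance.\<close>

lemma orthogonal_decomposition:
  fixes S :: "'a::complex_hilbert_space set"
  assumes S: "csubspace S" "closed S"
  obtains y where "y \<in> S" "\<And>s. s \<in> S \<Longrightarrow> cinner (x - y) s = 0"
proof -
  obtain y where y: "y \<in> S" "\<And>s. s \<in> S \<Longrightarrow> norm (x - y) \<le> norm (x - s)"
    using nearest_point_csubspace[OF S] by metis
  have "cinner (x - y) s = 0" if "s \<in> S" for s
  proof (rule ccontr)
    define a where "a = cinner (x - y) s"
    \<comment> \<open>This \<open>t\<close> is small enough for the linear term of the expanded
      square to dominate the quadratic one; the added 1 keeps the denominator positive and
      \<open>t * (norm s)\<^sup>2\<close> strictly below 1. The factor \<open>a\<close> in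
      \<open>c\<close> makes the linear term real and positive.\<close>
    define t where "t = 1 / ((norm s)\<^sup>2 + 1)"
    define c where "c = complex_of_real t * a"
    assume "cinner (x - y) s \<noteq> 0"
    then have a: "(cmod a)\<^sup>2 > 0" by (simp add: a_def)
    have t: "t > 0" "t * (norm s)\<^sup>2 < 1"
      by (auto simp: t_def add_nonneg_pos)
    have "y + c *\<^sub>C s \<in> S"
      using S(1) y(1) that by (intro complex_vector.subspace_add complex_vector.subspace_scale)
    then have "norm (x - y) \<le> norm ((x - y) - c *\<^sub>C s)"
      using y(2) by (simp add: diff_diff_eq)
    then have "(norm (x - y))\<^sup>2 \<le> (norm ((x - y) - c *\<^sub>C s))\<^sup>2"
      by (simp add: power_mono)
    then have "2 * Re (cnj c * a) \<le> (norm (c *\<^sub>C s))\<^sup>2"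
      by (simp add: norm_diff_squared cinner_scaleC_right a_def)
    moreover have "cnj c * a = complex_of_real (t * (cmod a)\<^sup>2)"
      by (simp add: c_def complex_norm_square mult_ac del: of_real_power)
    moreover have "(norm (c *\<^sub>C s))\<^sup>2 = t * (cmod a)\<^sup>2 * (t * (norm s)\<^sup>2)"
      by (simp add: norm_scaleC c_def norm_mult power_mult_distrib) (simp add: power2_eq_square)
    ultimately have "2 * (t * (cmod a)\<^sup>2) \<le> t * (cmod a)\<^sup>2 * (t * (norm s)\<^sup>2)"
      by simp
    moreover have "t * (cmod a)\<^sup>2 * (t * (norm s)\<^sup>2) < t * (cmod a)\<^sup>2 * 1"
      using a t by (intro mult_strict_left_mono) auto
    moreover have "t * (cmod a)\<^sup>2 > 0"
      using a t by simp
    ultimately show False by linarith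
  qed
  with y(1) show ?thesis
    using that by blast
qed

subsection \<open>Adjoints and projections\<close>

lemma bounded_ops_diff: "p \<in> bounded_ops \<Longrightarrow> p (x - y) = p x - p y"
  by (simp add: bounded_ops_def bounded_linear.linear linear_diff)

lemma bounded_ops_add: "p \<in> bounded_ops \<Longrightarrow> p (x + y) = p x + p y"
  by (simp add: bounded_ops_def bounded_linear.linear linear_add)

lemma bounded_ops_zero: "p \<in> bounded_ops \<Longrightarrow> p 0 = 0"
  by (simp add: bounded_ops_def bounded_linear.linear linear_0)

lemma bounded_ops_scaleC: "p \<in> bounded_ops \<Longrightarrow> p (c *\<^sub>C x) = c *\<^sub>C p x"
  by (simp add: bounded_ops_def)

lemma bounded_ops_continuous: "p \<in> bounded_ops \<Longrightarrow> continuous_on UNIV p"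
  by (simp add: bounded_ops_def linear_continuous_on)

text \<open>The kernel of a nonzero \<open>f\<close> is a closed subspace of codimension one, so
  there is a nonzero \<open>z\<close> orthogonal to it, and \<open>f\<close> is the inner product
  with a multiple of \<open>z\<close>.\<close>

lemma riesz_representation:
  fixes f :: "'a::complex_hilbert_space \<Rightarrow> complex"
  assumes cont: "continuous_on UNIV f"
    and add: "\<And>x y. f (x + y) = f x + f y" and scale: "\<And>c x. f (c *\<^sub>C x) = c * f x"
  obtains \<zeta> where "\<And>x. f x = cinner x \<zeta>"
proof (cases "\<forall>x. f x = 0")
  case True
  then show ?thesis
    using that[of 0] by simp
next
  case False
  then obtain x0 where x0: "f x0 \<noteq> 0" by blast
  let ?K = "{x. f x = 0}"
  have f0: "f 0 = 0"
    using add[of 0 0] by simp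
  have "csubspace ?K"
    by (simp add: complex_vector.subspace_def add scale f0)
  moreover have "closed ?K"
    by (rule closed_Collect_eq[OF cont continuous_on_const])
  ultimately obtain y where "y \<in> ?K" "\<And>s. s \<in> ?K \<Longrightarrow> cinner (x0 - y) s = 0"
    using orthogonal_decomposition[of ?K x0 thesis] by simp
  then have y: "f y = 0" "\<And>s. f s = 0 \<Longrightarrow> cinner (x0 - y) s = 0"
    by simp_all
  define z where "z = x0 - y"
  have "f (z + y) = f z + f y"
    by (rule add)
  then have fz: "f z \<noteq> 0"
    using x0 y(1) by (simp add: z_def)
  then have z: "cinner z z \<noteq> 0"
    using f0 by auto
  define \<zeta> where "\<zeta> = cnj (f z / cinner z z) *\<^sub>C z"
  have "f x = cinner x \<zeta>" for x
  proof -
    \<comment> \<open>Removing from \<open>x\<close> its component along \<open>z\<close> leaves a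
      vector in the kernel of \<open>f\<close>, hence orthogonal to \<open>z\<close>.\<close>
    define w where "w = x + (- (f x / f z)) *\<^sub>C z"
    have "f w = 0"
      using fz unfolding w_def add scale by simp
    then have "cinner w z = 0"
      using y(2)[of w, folded z_def] cinner_eq_0_sym[of w z] by simp
    then have "cinner x z = f x / f z * cinner z z"
      unfolding w_def cinner_add_left cinner_scaleC_left by (simp add: add_eq_0_iff2)
    then show ?thesis
      using fz z by (simp add: \<zeta>_def cinner_scaleC_right)
  qed
  then show ?thesis
    using that by blast
qed

section \<open>Adjoints of bounded operators\<close>

lemma adj_eqI:
  assumes "\<And>\<xi>. cinner (x \<xi>) \<eta> = cinner \<xi> \<zeta>"
  shows "adj x \<eta> = \<zeta>"
  unfolding adj_def
proof (rule the_equality)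
  show "\<forall>\<xi>. cinner (x \<xi>) \<eta> = cinner \<xi> \<zeta>"
    using assms by blast
next
  fix \<zeta>' assume "\<forall>\<xi>. cinner (x \<xi>) \<eta> = cinner \<xi> \<zeta>'"
  then have "cinner (\<zeta>' - \<zeta>) (\<zeta>' - \<zeta>) = 0"
    using assms by (simp add: cinner_diff_right)
  then show "\<zeta>' = \<zeta>" by simp
qed

text \<open>Riesz representation of the functional on the left shows that the definite description
  in \<open>adj\<close> denotes; the uniqueness half is \<open>adj_eqI\<close>.\<close>

lemma cinner_adj:
  assumes "x \<in> bounded_ops"
  shows "cinner (x \<xi>) \<eta> = cinner \<xi> (adj x \<eta>)"
proof -
  have "continuous_on UNIV (\<lambda>\<xi>. cinner (x \<xi>) \<eta>)"
    by (rule continuous_on_compose2[OF continuous_cinner_left bounded_ops_continuous[OF assms]]) simp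
  then obtain \<zeta> where "\<And>\<xi>. cinner (x \<xi>) \<eta> = cinner \<xi> \<zeta>"
    using riesz_representation[of "\<lambda>\<xi>. cinner (x \<xi>) \<eta>"] assms
    by (metis bounded_ops_add bounded_ops_scaleC cinner_add_left cinner_scaleC_left)
  then show ?thesis
    using adj_eqI by metis
qed

section \<open>Orthogonal projections and their ranges\<close>

lemma projection_bounded_ops: "is_projection p \<Longrightarrow> p \<in> bounded_ops"
  by (simp add: is_projection_def selfadjoint_def)

lemma projection_idem: "is_projection p \<Longrightarrow> p (p x) = p x"
  by (metis comp_apply is_projection_def)

lemma range_projection: "is_projection p \<Longrightarrow> range p = {x. p x = x}"
  by (auto simp: projection_idem) (metis rangeI)

lemma csubspace_range:
  assumes "p \<in> bounded_ops"
  shows "csubspace (range p)"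
  unfolding complex_vector.subspace_def
  using rangeI[of p 0] unfolding bounded_ops_zero[OF assms]
  by (auto simp flip: bounded_ops_add[OF assms] bounded_ops_scaleC[OF assms])

lemma closed_range_projection:
  assumes "is_projection p"
  shows "closed (range p)"
  unfolding range_projection[OF assms]
  using bounded_ops_continuous[OF projection_bounded_ops[OF assms]]
  by (rule closed_Collect_eq) (rule continuous_on_id)

text \<open>The two candidates differ by a vector of \<open>S\<close> that is orthogonal to
  \<open>S\<close>, hence to itself. This yields the linearity of projections and the fact that a
  projection is determined by its range.\<close>

lemma orthogonal_decomposition_unique:
  fixes S :: "'a::complex_hilbert_space set"
  assumes "csubspace S" "y \<in> S" "y' \<in> S"
    and "\<And>s. s \<in> S \<Longrightarrow> cinner (x - y) s = 0" "\<And>s. s \<in> S \<Longrightarrow> cinner (x - y') s = 0"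
  shows "y = y'"
proof -
  have "y - y' \<in> S"
    using assms by (simp add: complex_vector.subspace_diff)
  then have "cinner (x - y') (y - y') - cinner (x - y) (y - y') = 0"
    using assms by simp
  then have "cinner (y - y') (y - y') = 0"
    unfolding cinner_diff_left[symmetric] by simp
  then show ?thesis by simp
qed

text \<open>Self-adjointness moves \<open>p\<close> from \<open>s = p s\<close> over to
  \<open>x - p x\<close>, which \<open>p\<close> annihilates by idempotence.\<close>

lemma projection_orthogonal:
  assumes "is_projection p" "s \<in> range p"
  shows "cinner (x - p x) s = 0"
proof -
  have p: "p \<in> bounded_ops" "adj p = p"
    using assms(1) by (auto simp: is_projection_def selfadjoint_def)
  have "cinner (x - p x) (p s) = cinner (p (x - p x)) s"
    using cinner_adj[OF p(1)] p(2) by simp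
  also have "p (x - p x) = 0"
    using assms(1) p(1) by (simp add: bounded_ops_diff projection_idem)
  finally show ?thesis
    using assms range_projection by force
qed

text \<open>The map \<open>p\<close> picks the component in \<open>S\<close> of the orthogonal
  decomposition. Linearity and the fixing of \<open>S\<close> follow from uniqueness of that
  component, contractivity from Pythagoras.\<close>

lemma projection_onto_exists:
  fixes S :: "'a::complex_hilbert_space set"
  assumes S: "csubspace S" "closed S"
  obtains p where "is_projection p" "range p = S"
proof -
  have "\<exists>y. y \<in> S \<and> (\<forall>s\<in>S. cinner (x - y) s = 0)" for x
    using orthogonal_decomposition[OF S] by metis
  then obtain p where pS: "\<And>x. p x \<in> S" and p: "\<And>x s. s \<in> S \<Longrightarrow> cinner (x - p x) s = 0"
    by metis
  have unique: "p x = y" if "y \<in> S" "\<And>s. s \<in> S \<Longrightarrow> cinner (x - y) s = 0" for x y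
    using orthogonal_decomposition_unique[OF S(1) pS that(1) p that(2)] by simp
  have fixed: "p x = x" if "x \<in> S" for x
    using that by (intro unique) auto
  have add: "p (x + y) = p x + p y" for x y
  proof (rule unique)
    show "p x + p y \<in> S"
      using S(1) pS by (simp add: complex_vector.subspace_add)
    show "cinner (x + y - (p x + p y)) s = 0" if "s \<in> S" for s
      using p[OF that, of x] p[OF that, of y] by (simp add: cinner_diff_left cinner_add_left)
  qed
  have scale: "p (c *\<^sub>C x) = c *\<^sub>C p x" for c x
  proof (rule unique)
    show "c *\<^sub>C p x \<in> S"
      using S(1) pS by (simp add: complex_vector.subspace_scale)
    show "cinner (c *\<^sub>C x - c *\<^sub>C p x) s = 0" if "s \<in> S" for s
      using p[OF that, of x] by (simp add: cinner_diff_left cinner_scaleC_left)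
  qed
  have "norm (p x) \<le> norm x" for x
  proof -
    have "(norm x)\<^sup>2 = (norm (x - p x))\<^sup>2 + (norm (p x))\<^sup>2"
      using norm_add_squared[of "x - p x" "p x"] p[OF pS, of x x] by simp
    then have "(norm (p x))\<^sup>2 \<le> (norm x)\<^sup>2"
      by (metis le_add_same_cancel2 zero_le_power2)
    then show ?thesis
      by (rule power2_le_imp_le) simp
  qed
  then have "bounded_linear p"
    by (intro bounded_linear_intro[where K = 1]) (auto simp: add scale scaleR_scaleC)
  then have bdd: "p \<in> bounded_ops"
    by (simp add: bounded_ops_def scale)
  have "adj p = p"
  proof (intro ext adj_eqI)
    fix \<eta> \<xi>
    \<comment> \<open>Either argument may be replaced by its projection when the other lies in
      \<open>S\<close>, since the remainder is orthogonal to \<open>S\<close>.\<close>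
    have "cinner \<xi> (p \<eta>) = cinner (p \<xi>) (p \<eta>)"
      using p[OF pS, of \<xi> \<eta>] by (simp add: cinner_diff_left)
    also have "\<dots> = cinner (p \<xi>) \<eta>"
      using p[OF pS, of \<eta> \<xi>] unfolding cinner_eq_0_sym[of "\<eta> - p \<eta>"]
      by (simp add: cinner_diff_right)
    finally show "cinner (p \<xi>) \<eta> = cinner \<xi> (p \<eta>)" by simp
  qed
  with bdd have "is_projection p"
    by (auto simp: is_projection_def selfadjoint_def fixed pS)
  moreover have "range p = S"
    using pS fixed by (auto simp: image_iff) metis
  ultimately show ?thesis
    using that by blast
qed

text \<open>Justifies the definite description in \<open>proj_onto\<close>: a projection exists, and
  any other with the same range gives the same orthogonal decomposition of every vector.\<close>

lemma range_proj_onto: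
  fixes S :: "'a::complex_hilbert_space set"
  assumes "csubspace S" "closed S"
  shows "range (proj_onto S) = S"
proof -
  obtain p where p: "is_projection p" "range p = S"
    using projection_onto_exists[OF assms] by blast
  have "proj_onto S = p"
    unfolding proj_onto_def
  proof (rule the_equality)
    fix q assume q: "is_projection q \<and> range q = S"
    show "q = p"
    proof
      fix x
      show "q x = p x"
        using p q projection_orthogonal
        by (intro orthogonal_decomposition_unique[OF assms(1), of "q x" "p x" x]) blast+
    qed
  qed (use p in blast)
  with p show ?thesis by simp
qed

text \<open>This and the next lemma turn lattice conditions on projections into conditions on
  ranges: \<open>range_proj_onto\<close> identifies the range of the meet or join, while the zero
  operator and the identity have ranges \<open>{0}\<close> and \<open>UNIV\<close>.\<close>

lemma range_inter_of_proj_inf_zero: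
  assumes "is_projection p" "is_projection q" "proj_inf p q = (\<lambda>_. 0)"
  shows "range p \<inter> range q = {0}"
proof -
  have "range (proj_onto (range p \<inter> range q)) = range p \<inter> range q"
    using assms
    by (intro range_proj_onto complex_vector.subspace_inter closed_Int csubspace_range
        closed_range_projection projection_bounded_ops)
  then show ?thesis
    using assms(3) by (simp add: proj_inf_def)
qed

lemma closure_range_plus_of_proj_sup_id:
  assumes "is_projection p" "is_projection q" "proj_sup p q = id"
  shows "closure (range p + range q) = UNIV"
proof -
  have "range (proj_onto (closure (range p + range q))) = closure (range p + range q)"
    using assms
    by (intro range_proj_onto csubspace_closure csubspace_set_plus csubspace_range
        closed_closure projection_bounded_ops)
  then show ?thesis
    using assms(3) by (simp add: proj_sup_def)
qed

subsection \<open>Closed idempotent operators\<close>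

lemma lin_operator_unique: "lin_operator T \<Longrightarrow> (\<xi>, \<eta>) \<in> T \<Longrightarrow> (\<xi>, \<eta>') \<in> T \<Longrightarrow> \<eta> = \<eta>'"
  unfolding lin_operator_def single_valued_def by blast

lemma lin_operator_zero: "lin_operator T \<Longrightarrow> (0, 0) \<in> T"
  unfolding lin_operator_def by blast

lemma lin_operator_add:
  "lin_operator T \<Longrightarrow> (\<xi>, \<eta>) \<in> T \<Longrightarrow> (\<xi>', \<eta>') \<in> T \<Longrightarrow> (\<xi> + \<xi>', \<eta> + \<eta>') \<in> T"
  unfolding lin_operator_def by blast

lemma lin_operator_scaleC: "lin_operator T \<Longrightarrow> (\<xi>, \<eta>) \<in> T \<Longrightarrow> (c *\<^sub>C \<xi>, c *\<^sub>C \<eta>) \<in> T"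
  unfolding lin_operator_def by blast

lemma lin_operator_diff:
  assumes "lin_operator T" "(\<xi>, \<eta>) \<in> T" "(\<xi>', \<eta>') \<in> T"
  shows "(\<xi> - \<xi>', \<eta> - \<eta>') \<in> T"
  using lin_operator_add[OF assms(1,2) lin_operator_scaleC[OF assms(1,3), of "- 1"]] by simp

text \<open>A single-valued relation cannot properly extend a relation with the same domain.\<close>

lemma lin_operator_eqI:
  assumes "lin_operator T" "S \<subseteq> T" "Domain T \<subseteq> Domain S"
  shows "T = S"
  using assms lin_operator_unique[OF assms(1)] by fast

section \<open>Structure of a closed operator that is the closure of its square\<close>

locale closed_idempotent =
  fixes E :: "'a::complex_hilbert_space operator"
  assumes lin: "lin_operator E"
    and closed: "closed E"
    and idem: "closure (E O E) = E"
begin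

lemma range_fixed:
  assumes "(\<xi>, \<eta>) \<in> E"
  shows "(\<eta>, \<eta>) \<in> E"
proof -
  have "E O E \<subseteq> E"
    using closure_subset[of "E O E"] unfolding idem .
  have "(\<xi>, \<eta>) \<in> closure (E O E)"
    using assms idem by simp
  then obtain f where f: "\<And>n. f n \<in> E O E" "f \<longlonglongrightarrow> (\<xi>, \<eta>)"
    unfolding closure_sequential by blast
  have "(snd (f n), snd (f n)) \<in> E" for n
  proof -
    obtain a b c where abc: "f n = (a, c)" "(a, b) \<in> E" "(b, c) \<in> E"
      using f(1)[of n] by auto
    moreover from this have "(a, c) \<in> E"
      using \<open>E O E \<subseteq> E\<close> by blast
    \<comment> \<open>Both \<open>b\<close> and \<open>c\<close> are values of \<open>E\<close> at
      \<open>a\<close>, so they agree and \<open>(b, c)\<close> is the pair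
      \<open>(c, c)\<close>.\<close>
    ultimately show ?thesis
      using lin_operator_unique[OF lin] by auto
  qed
  moreover have "(\<lambda>n. (snd (f n), snd (f n))) \<longlonglongrightarrow> (\<eta>, \<eta>)"
    using tendsto_snd[OF f(2)] by (intro tendsto_Pair) auto
  ultimately show ?thesis
    by (rule closed_sequentially[OF closed])
qed

lemma Range_eq: "Range E = {\<xi>. (\<xi>, \<xi>) \<in> E}"
  using range_fixed by auto

lemma csubspace_Range: "csubspace (Range E)"
  unfolding Range_eq complex_vector.subspace_def
  using lin_operator_zero[OF lin] lin_operator_add[OF lin] lin_operator_scaleC[OF lin] by blast

lemma csubspace_ker: "csubspace (op_ker E)"
  unfolding op_ker_def complex_vector.subspace_def
  using lin_operator_zero[OF lin] lin_operator_add[OF lin, of _ 0 _ 0]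
    lin_operator_scaleC[OF lin, of _ 0] by simp

text \<open>The fixed-point description makes the range the preimage of the closed graph under the
  continuous diagonal map; the kernel is treated likewise with
  \<open>\<xi> \<mapsto> (\<xi>, 0)\<close>.\<close>

lemma closed_Range: "closed (Range E)"
proof -
  have "closed ((\<lambda>\<xi>. (\<xi>, \<xi>)) -` E)"
    by (intro closed_vimage closed continuous_intros)
  then show ?thesis
    by (simp add: Range_eq vimage_def)
qed

lemma closed_ker: "closed (op_ker E)"
proof -
  have "closed ((\<lambda>\<xi>. (\<xi>, 0)) -` E)"
    by (intro closed_vimage closed continuous_intros)
  then show ?thesis
    by (simp add: op_ker_def vimage_def)
qed

lemma Range_Int_ker: "Range E \<inter> op_ker E = {0}"
  unfolding Range_eq op_ker_def
  using lin_operator_unique[OF lin] lin_operator_zero[OF lin] by auto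

text \<open>Since \<open>E\<close> fixes its values, it sends \<open>\<xi> - \<eta>\<close> to
  \<open>\<eta> - \<eta>\<close>; conversely a kernel vector is its own difference with its value
  0.\<close>

lemma ker_eq: "op_ker E = {\<xi> - \<eta> |\<xi> \<eta>. (\<xi>, \<eta>) \<in> E}"
proof (intro set_eqI iffI)
  fix \<zeta> assume "\<zeta> \<in> op_ker E"
  then show "\<zeta> \<in> {\<xi> - \<eta> |\<xi> \<eta>. (\<xi>, \<eta>) \<in> E}"
    by (intro CollectI exI[of _ \<zeta>] exI[of _ 0]) (simp add: op_ker_def)
next
  fix \<zeta> assume "\<zeta> \<in> {\<xi> - \<eta> |\<xi> \<eta>. (\<xi>, \<eta>) \<in> E}"
  then obtain \<xi> \<eta> where "\<zeta> = \<xi> - \<eta>" "(\<xi>, \<eta>) \<in> E" by blast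
  then show "\<zeta> \<in> op_ker E"
    using lin_operator_diff[OF lin _ range_fixed, of \<xi> \<eta> \<xi> \<eta>] by (simp add: op_ker_def)
qed

lemma Domain_eq: "Domain E = Range E + op_ker E"
proof (intro set_eqI iffI)
  fix \<xi> assume "\<xi> \<in> Domain E"
  then obtain \<eta> where "(\<xi>, \<eta>) \<in> E" by blast
  then have "\<eta> \<in> Range E" "\<xi> - \<eta> \<in> op_ker E"
    by (auto simp: ker_eq)
  then show "\<xi> \<in> Range E + op_ker E"
    using set_plus_intro[of \<eta> _ "\<xi> - \<eta>"] by simp
next
  fix \<zeta> assume "\<zeta> \<in> Range E + op_ker E"
  then obtain \<xi> \<eta> where "\<zeta> = \<xi> + \<eta>" "(\<xi>, \<xi>) \<in> E" "(\<eta>, 0) \<in> E"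
    unfolding Range_eq op_ker_def by (auto elim: set_plus_elim)
  then show "\<zeta> \<in> Domain E"
    using lin_operator_add[OF lin] by blast
qed

text \<open>The graph of \<open>1 - E\<close>, on the domain of \<open>E\<close>, is already closed,
  so the closure in \<open>strong_add\<close> adds nothing and \<open>ker_eq\<close>
  applies.\<close>

lemma ker_eq_Range_complement:
  "op_ker E = Range (strong_add (op_graph id) (op_uminus E))"
proof -
  have diff: "op_plus (op_graph id) (op_uminus E) = {(\<xi>, \<xi> - \<eta>) |\<xi> \<eta>. (\<xi>, \<eta>) \<in> E}"
    by (simp add: op_plus_def op_graph_def op_uminus_def set_eq_iff)
      (metis add.inverse_inverse add_uminus_conv_diff)
  \<comment> \<open>The map \<open>(\<xi>, \<zeta>) \<mapsto> (\<xi>, \<xi> - \<zeta>)\<close> is a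
    continuous involution exchanging the graphs of \<open>1 - E\<close> and
    \<open>E\<close>.\<close>
  also have "\<dots> = (\<lambda>z. (fst z, fst z - snd z)) -` E"
    by (auto simp: vimage_def) (metis diff_diff_eq2 add_diff_cancel_left')
  finally have "closed (op_plus (op_graph id) (op_uminus E))"
    by (simp only:) (intro closed_vimage closed continuous_intros)
  then have "strong_add (op_graph id) (op_uminus E) = {(\<xi>, \<xi> - \<eta>) |\<xi> \<eta>. (\<xi>, \<eta>) \<in> E}"
    by (simp add: strong_add_def diff)
  then show ?thesis
    by (auto simp: ker_eq)
qed

end

lemma idempotents_closed_idempotent: "E \<in> idempotents M \<Longrightarrow> closed_idempotent E"
  by unfold_locales
    (simp_all add: idempotents_def affiliated_def strong_mult_def op_comp_def)

section \<open>The projection onto one subspace along another\<close>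

definition oblique_projection :: "'a::complex_hilbert_space set \<Rightarrow> 'a set \<Rightarrow> 'a operator"
  where "oblique_projection A B = {(\<xi> + \<eta>, \<xi>) |\<xi> \<eta>. \<xi> \<in> A \<and> \<eta> \<in> B}"

text \<open>Eliminates the choice of a decomposition: the component in \<open>B\<close> can only be
  \<open>\<zeta> - \<xi>\<close>. Linearity, closedness and idempotence thus reduce to separate
  conditions on \<open>A\<close> and \<open>B\<close>.\<close>

lemma oblique_projection_iff: "(\<zeta>, \<xi>) \<in> oblique_projection A B \<longleftrightarrow> \<xi> \<in> A \<and> \<zeta> - \<xi> \<in> B"
proof
  assume "\<xi> \<in> A \<and> \<zeta> - \<xi> \<in> B"
  then show "(\<zeta>, \<xi>) \<in> oblique_projection A B"
    unfolding oblique_projection_def by (intro CollectI exI[of _ \<xi>] exI[of _ "\<zeta> - \<xi>"]) simp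
qed (auto simp: oblique_projection_def)

lemma Domain_oblique_projection: "Domain (oblique_projection A B) = A + B"
  by (auto simp: oblique_projection_def set_plus_def)

lemma lin_operator_oblique_projection:
  assumes "csubspace A" "csubspace B" "A \<inter> B = {0}"
  shows "lin_operator (oblique_projection A B)"
proof -
  have "single_valued (oblique_projection A B)"
  proof (rule single_valuedI)
    fix \<zeta> \<xi> \<xi>'
    assume "(\<zeta>, \<xi>) \<in> oblique_projection A B" "(\<zeta>, \<xi>') \<in> oblique_projection A B"
    \<comment> \<open>The difference of the two values is also the difference of the two components
      in \<open>B\<close>, taken in reverse order.\<close>
    then have "\<xi> - \<xi>' \<in> A" "(\<zeta> - \<xi>') - (\<zeta> - \<xi>) \<in> B"
      unfolding oblique_projection_iff
      by (blast intro: complex_vector.subspace_diff assms(1,2))+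
    then have "\<xi> - \<xi>' \<in> A \<inter> B" by simp
    then show "\<xi> = \<xi>'"
      using assms(3) by simp
  qed
  moreover have "(\<xi> + \<xi>', \<eta> + \<eta>') \<in> oblique_projection A B"
    if "(\<xi>, \<eta>) \<in> oblique_projection A B" "(\<xi>', \<eta>') \<in> oblique_projection A B" for \<xi> \<eta> \<xi>' \<eta>'
    using that assms(1,2) complex_vector.subspace_add[OF assms(2), of "\<xi> - \<eta>" "\<xi>' - \<eta>'"]
    by (simp add: oblique_projection_iff complex_vector.subspace_add add_diff_add)
  moreover have "(c *\<^sub>C \<xi>, c *\<^sub>C \<eta>) \<in> oblique_projection A B"
    if "(\<xi>, \<eta>) \<in> oblique_projection A B" for c \<xi> \<eta>
    using that assms(1,2)
    by (simp add: oblique_projection_iff complex_vector.subspace_scale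
        flip: complex_vector.scale_right_diff_distrib)
  moreover have "(0, 0) \<in> oblique_projection A B"
    using assms(1,2) by (simp add: oblique_projection_iff complex_vector.subspace_0)
  ultimately show ?thesis
    unfolding lin_operator_def by blast
qed

lemma closed_oblique_projection:
  fixes A B :: "'a::complex_hilbert_space set"
  assumes "closed A" "closed B"
  shows "closed (oblique_projection A B)"
proof -
  have "oblique_projection A B = snd -` A \<inter> (\<lambda>z. fst z - snd z) -` B"
    by (auto simp: oblique_projection_iff)
  then show ?thesis
    using assms by (auto intro!: closed_Int closed_vimage continuous_intros)
qed

text \<open>Holds before any closure is taken; for closed \<open>A\<close> and \<open>B\<close> the
  closure in \<open>strong_mult\<close> then changes nothing.\<close>

lemma oblique_projection_idem:
  assumes "csubspace A" "csubspace B"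
  shows "oblique_projection A B O oblique_projection A B = oblique_projection A B"
proof (intro set_eqI iffI)
  fix z assume "z \<in> oblique_projection A B O oblique_projection A B"
  then obtain a b c where z: "z = (a, c)"
    "b \<in> A" "a - b \<in> B" "c \<in> A" "b - c \<in> B"
    by (auto simp: oblique_projection_iff)
  then have "(a - b) + (b - c) \<in> B"
    using assms(2) complex_vector.subspace_add by blast
  then show "z \<in> oblique_projection A B"
    using z by (simp add: oblique_projection_iff)
next
  fix z assume "z \<in> oblique_projection A B"
  then obtain a c where z: "z = (a, c)" "c \<in> A" "a - c \<in> B"
    by (cases z) (auto simp: oblique_projection_iff)
  moreover from this have "(c, c) \<in> oblique_projection A B"
    using complex_vector.subspace_0[OF assms(2)] by (simp add: oblique_projection_iff)
  ultimately show "z \<in> oblique_projection A B O oblique_projection A B"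
    by (auto simp: oblique_projection_iff)
qed

lemma Range_oblique_projection:
  assumes "csubspace B"
  shows "Range (oblique_projection A B) = A"
proof -
  have "(\<xi>, \<xi>) \<in> oblique_projection A B" if "\<xi> \<in> A" for \<xi>
    using that complex_vector.subspace_0[OF assms] by (simp add: oblique_projection_iff)
  then have "A \<subseteq> Range (oblique_projection A B)"
    by blast
  then show ?thesis
    by (auto simp: oblique_projection_iff)
qed

lemma ker_oblique_projection:
  assumes "csubspace A"
  shows "op_ker (oblique_projection A B) = B"
  using complex_vector.subspace_0[OF assms] by (simp add: op_ker_def oblique_projection_iff)

text \<open>Additivity forces the values on \<open>A + B\<close>, and a single-valued
  \<open>T\<close> with no larger domain contains nothing else. Both the uniqueness of the
  idempotent and its determination by its values rest on this.\<close>

lemma oblique_projection_eqI: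
  assumes "lin_operator T" "Domain T = A + B"
    and "\<And>\<xi>. \<xi> \<in> A \<Longrightarrow> (\<xi>, \<xi>) \<in> T" "\<And>\<xi>. \<xi> \<in> B \<Longrightarrow> (\<xi>, 0) \<in> T"
  shows "T = oblique_projection A B"
proof (rule lin_operator_eqI[OF assms(1)])
  show "oblique_projection A B \<subseteq> T"
    using lin_operator_add[OF assms(1) assms(3,4)] by (auto simp: oblique_projection_def)
qed (simp add: assms(2) Domain_oblique_projection)

text \<open>The range of \<open>p\<close> is its set of fixed points; as \<open>u\<close> commutes
  with \<open>p\<close> and is injective, it neither creates nor destroys them.\<close>

lemma unitary_commuting_mem_range_iff:
  assumes "unitary_op u" "p \<circ> u = u \<circ> p" "is_projection p"
  shows "u \<xi> \<in> range p \<longleftrightarrow> \<xi> \<in> range p"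
proof -
  have "inj u"
    using assms(1) unfolding unitary_op_def by (metis inj_on_id inj_on_imageI2)
  have "u \<xi> \<in> range p \<longleftrightarrow> u (p \<xi>) = u \<xi>"
    using assms(2) by (simp add: range_projection[OF assms(3)]) (metis comp_apply)
  also have "\<dots> \<longleftrightarrow> \<xi> \<in> range p"
    using \<open>inj u\<close> by (simp add: range_projection[OF assms(3)] inj_eq)
  finally show ?thesis .
qed

text \<open>A unitary in the commutant of \<open>M\<close> commutes with \<open>P\<close> and
  \<open>Q\<close>, so it preserves membership in both ranges in both directions, and hence in the
  graph.\<close>

lemma oblique_projection_affiliated:
  assumes PQ: "P \<in> M" "Q \<in> M" "is_projection P" "is_projection Q"
    and zero: "range P \<inter> range Q = {0}" and dense: "closure (range P + range Q) = UNIV"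
  shows "oblique_projection (range P) (range Q) \<in> affiliated M"
proof -
  let ?E = "oblique_projection (range P) (range Q)"
  have "op_comp (op_graph u) ?E = op_comp ?E (op_graph u)"
    if u: "u \<in> commutant M" "unitary_op u" for u
  proof -
    have bdd: "u \<in> bounded_ops" and comm: "P \<circ> u = u \<circ> P" "Q \<circ> u = u \<circ> Q"
      using u(1) PQ by (auto simp: commutant_def)
    have "surj u"
      using u(2) unfolding unitary_op_def by (metis comp_apply id_apply surjI)
    have iff: "(u \<zeta>, u \<xi>) \<in> ?E \<longleftrightarrow> (\<zeta>, \<xi>) \<in> ?E" for \<zeta> \<xi>
      using unitary_commuting_mem_range_iff[OF u(2)] comm PQ
      by (simp add: oblique_projection_iff flip: bounded_ops_diff[OF bdd])
    have "(\<zeta>, \<eta>) \<in> op_comp (op_graph u) ?E \<longleftrightarrow> (\<zeta>, \<eta>) \<in> op_comp ?E (op_graph u)" for \<zeta> \<eta>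
    proof -
      \<comment> \<open>Surjectivity writes the second coordinate as a value of \<open>u\<close>, so
        that \<open>iff\<close> can compare the two compositions.\<close>
      obtain \<xi> where "\<eta> = u \<xi>"
        using \<open>surj u\<close> by blast
      then show ?thesis
        using iff u(2)
        by (auto simp: op_comp_def op_graph_def unitary_op_def relcomp_unfold)
          (metis comp_apply id_apply)+
    qed
    then show ?thesis by auto
  qed
  then show ?thesis
    using PQ zero dense
    by (simp add: affiliated_def lin_operator_oblique_projection closed_oblique_projection
        csubspace_range projection_bounded_ops closed_range_projection Domain_oblique_projection)
qed

lemma oblique_projection_idempotents:
  assumes "P \<in> M" "Q \<in> M" "is_projection P" "is_projection Q"
    and "range P \<inter> range Q = {0}" "closure (range P + range Q) = UNIV"
  shows "oblique_projection (range P) (range Q) \<in> idempotents M"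
  using oblique_projection_affiliated[OF assms] assms(3,4)
  by (simp add: idempotents_def strong_mult_def op_comp_def oblique_projection_idem
      csubspace_range projection_bounded_ops closed_oblique_projection closed_range_projection)

theorem proposition2p4:
  fixes M :: "('a::complex_hilbert_space \<Rightarrow> 'a) set"
    and \<tau> :: "('a \<Rightarrow> 'a) \<Rightarrow> complex"
  assumes "finite_von_neumann_algebra M"
    and "state_on M \<tau>" and "faithful_on M \<tau>" and "normal_on M \<tau>" and "tracial_on M \<tau>"
  shows "(\<forall>E \<in> idempotents M.
            op_ker E = Range (strong_add (op_graph id) (op_uminus E)) \<and>
            csubspace (Range E) \<and> closed (Range E) \<and>
            csubspace (op_ker E) \<and> closed (op_ker E) \<and>
            Range E \<inter> op_ker E = {0} \<and>
            closure (Range E + op_ker E) = UNIV \<and>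
            Domain E = Range E + op_ker E) \<and>
         (\<forall>P \<in> M. \<forall>Q \<in> M.
            is_projection P \<and> is_projection Q \<and>
            proj_inf P Q = (\<lambda>_. 0) \<and> proj_sup P Q = id \<longrightarrow>
            (\<exists>!E. E \<in> idempotents M \<and> Domain E = range P + range Q \<and>
                  Range E = range P \<and> op_ker E = range Q) \<and>
            (\<forall>E. E \<in> idempotents M \<and> Domain E = range P + range Q \<and>
                  Range E = range P \<and> op_ker E = range Q \<longrightarrow>
               (\<forall>\<xi> \<in> range P. (\<xi>, \<xi>) \<in> E) \<and> (\<forall>\<xi> \<in> range Q. (\<xi>, 0) \<in> E) \<and>
               (\<forall>T. lin_operator T \<and> Domain T = range P + range Q \<and>
                  (\<forall>\<xi> \<in> range P. (\<xi>, \<xi>) \<in> T) \<and> (\<forall>\<xi> \<in> range Q. (\<xi>, 0) \<in> T) \<longrightarrow>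
                  T = E)))"
proof (intro conjI ballI impI)
  fix E assume E: "E \<in> idempotents M"
  interpret closed_idempotent E
    using E by (rule idempotents_closed_idempotent)
  show "op_ker E = Range (strong_add (op_graph id) (op_uminus E))"
    by (rule ker_eq_Range_complement)
  show "csubspace (Range E)" "closed (Range E)" "csubspace (op_ker E)" "closed (op_ker E)"
    by (rule csubspace_Range closed_Range csubspace_ker closed_ker)+
  show "Range E \<inter> op_ker E = {0}" "Domain E = Range E + op_ker E"
    by (rule Range_Int_ker Domain_eq)+
  \<comment> \<open>The domain of an affiliated operator is dense, and it has just been identified
    with the sum.\<close>
  then show "closure (Range E + op_ker E) = UNIV"
    using E by (simp add: idempotents_def affiliated_def)
next
  fix P Q assume M: "P \<in> M" "Q \<in> M"
    and "is_projection P \<and> is_projection Q \<and> proj_inf P Q = (\<lambda>_. 0) \<and> proj_sup P Q = id"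
  then have PQ: "is_projection P" "is_projection Q"
    and zero: "range P \<inter> range Q = {0}" and dense: "closure (range P + range Q) = UNIV"
    by (simp_all add: range_inter_of_proj_inf_zero closure_range_plus_of_proj_sup_id)
  have sub: "csubspace (range P)" "csubspace (range Q)"
    using PQ by (auto intro: csubspace_range projection_bounded_ops)
  let ?I = "\<lambda>E. E \<in> idempotents M \<and> Domain E = range P + range Q \<and>
    Range E = range P \<and> op_ker E = range Q"
  let ?E = "oblique_projection (range P) (range Q)"
  \<comment> \<open>An idempotent is the identity on its range, so the prescribed range and kernel
    already fix the values on \<open>range P\<close> and \<open>range Q\<close>.\<close>
  have fixed: "(\<xi>, \<xi>) \<in> E" if "?I E" "\<xi> \<in> range P" for E \<xi>
    using that closed_idempotent.Range_eq[OF idempotents_closed_idempotent] by blast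
  have kills: "(\<xi>, 0) \<in> E" if "?I E" "\<xi> \<in> range Q" for E \<xi>
    using that unfolding op_ker_def by blast
  have unique: "E = ?E" if "?I E" for E
    using that closed_idempotent.lin[OF idempotents_closed_idempotent]
    by (intro oblique_projection_eqI fixed[OF that] kills[OF that]) blast+
  show "\<exists>!E. ?I E"
    using oblique_projection_idempotents[OF M PQ zero dense] unique sub
    by (intro ex1I[of _ ?E])
      (simp_all add: Domain_oblique_projection Range_oblique_projection ker_oblique_projection)
  show "\<forall>E. ?I E \<longrightarrow>
      (\<forall>\<xi> \<in> range P. (\<xi>, \<xi>) \<in> E) \<and> (\<forall>\<xi> \<in> range Q. (\<xi>, 0) \<in> E) \<and>
      (\<forall>T. lin_operator T \<and> Domain T = range P + range Q \<and>
        (\<forall>\<xi> \<in> range P. (\<xi>, \<xi>) \<in> T) \<and> (\<forall>\<xi> \<in> range Q. (\<xi>, 0) \<in> T) \<longrightarrow> T = E)"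
  proof (intro allI impI)
    fix E assume E: "?I E"
    have "T = E" if "lin_operator T" "Domain T = range P + range Q"
      "\<forall>\<xi> \<in> range P. (\<xi>, \<xi>) \<in> T" "\<forall>\<xi> \<in> range Q. (\<xi>, 0) \<in> T" for T
      unfolding unique[OF E] using that by (intro oblique_projection_eqI) blast+
    then show "(\<forall>\<xi> \<in> range P. (\<xi>, \<xi>) \<in> E) \<and> (\<forall>\<xi> \<in> range Q. (\<xi>, 0) \<in> E) \<and>
      (\<forall>T. lin_operator T \<and> Domain T = range P + range Q \<and>
        (\<forall>\<xi> \<in> range P. (\<xi>, \<xi>) \<in> T) \<and> (\<forall>\<xi> \<in> range Q. (\<xi>, 0) \<in> T) \<longrightarrow> T = E)"
      using fixed[OF E] kills[OF E] by blast
  qed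
qed

end
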